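(* Let $f:\mathbb{R}^n\to\mathbb{R}$ be convex with bounded level sets, and suppose there exist a point $\bar x\in\mathbb{R}^n$ and $\epsilon>0$ such that $\langle a_j,\bar x\rangle-b_j\le-\epsilon$ for all $j=1,\ldots,m$. Let $c>0$ be arbitrary and let $L=L(c,\epsilon)$ be the subgradient bound defined in the context. Let the penalty parameters $\gamma>0$ and $\delta$ be chosen such that $$0<\delta<\min\left\{\epsilon,\frac{16\alpha_{\min}^2}{\beta^2m^2}\right\},\qquad \gamma\delta\le c,\qquad \gamma\ge\Gamma,$$ where $$\Gamma=\max\left\{L\left(\frac{1}{m\beta}-\frac{\sqrt{\delta}}{4\alpha_{\min}}\right)^{-1},\ 4mL\alpha_{\max}\left(\frac{1}{\sqrt{\delta}}+\frac{\beta m}{\alpha_{\min}}\right)\right\}.$$ Then every minimizer of $F_{\gamma\delta}$ over $\mathbb{R}^n$ is feasible for the original problem, i.e. $X^*_{\gamma\delta}\subseteq X$.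
   Context: Original problem: minimize a convex function $f:\mathbb{R}^n\to\mathbb{R}$ subject to $\langle a_i,x\rangle-b_i\le0$, $i=1,\ldots,m$ ($m\ge2$), where $a_i\in\mathbb{R}^n$ are nonzero and $b_i\in\mathbb{R}$. The problem is feasible. Put $X_i=\{x\in\mathbb{R}^n\mid\langle a_i,x\rangle-b_i\le0\}$ and $X=\cap_{i=1}^mX_i$. Norms are Euclidean, $\Pi_Y[x]$ is the Euclidean projection onto a closed convex set $Y$, and $\mathrm{dist}(x,Y)=\|x-\Pi_Y[x]\|$. For nonzero $a\in\mathbb{R}^n$, $b\in\mathbb{R}$ and $\delta>0$: $h_\delta(x;a,b)=\frac{\langle a,x\rangle-b}{\|a\|}$ if $\langle a,x\rangle-b>\delta$; $h_\delta(x;a,b)=\frac{(\langle a,x\rangle-b+\delta)^2}{4\delta\|a\|}$ if $-\delta\le\langle a,x\rangle-b\le\delta$; $h_\delta(x;a,b)=0$ if $\langle a,x\rangle-b<-\delta$. Penalized objective: $F_{\gamma\delta}(x)=f(x)+\frac{\gamma}{m}\sum_{i=1}^mh_\delta(x;a_i,b_i)$. $X^*_{\gamma\delta}$ is the set of minimizers of $F_{\gamma\delta}$ over $\mathbb{R}^n$. $\alpha_{\min}=\min_j\|a_j\|$, $\alpha_{\max}=\max_j\|a_j\|$. Hoffman's constant: $\beta=\beta(a_1,\ldots,a_m)>0$ is a constant depending only on $a_1,\ldots,a_m$ (not on the right-hand sides) such that, for every choice of right-hand sides $b'_1,\ldots,b'_m\in\mathbb{R}$ for which $Y=\cap_iY_i\ne\emptyset$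 with $Y_i=\{x\mid\langle a_i,x\rangle\le b'_i\}$, one has $\beta\sum_{i=1}^m\mathrm{dist}(x,Y_i)\ge\mathrm{dist}(x,Y)$ for all $x\in\mathbb{R}^n$ (in particular for $X_i$ and $X$). Subgradient bound: $R(c,\epsilon)>0$ is a radius such that, for all $\gamma>0$ and $0<\delta\le\epsilon$ with $\gamma\delta\le c$ and every $x\in X^*_{\gamma\delta}$, the ball $\{z\mid\|z\|\le R(c,\epsilon)\}$ contains $\Pi_X[x]$ and every feasible point $x_{in}\in X$ satisfying $\|x-x_{in}\|\le\|x-\Pi_X[x]\|+\frac{\beta m\delta}{\alpha_{\min}}$ (such a radius exists when $f$ has bounded level sets). Then $L(c,\epsilon)=\max\{\|s\|\mid s\in\partial f(x),\ \|x\|\le R(c,\epsilon)\}$, where $\partial f(x)$ is the subdifferential. *)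

theory Defs
  imports "HOL-Analysis.Analysis"
begin

definition halfspace :: "real ^ 'n \<Rightarrow> real \<Rightarrow> (real ^ 'n) set" where
  "halfspace a b = {x. a \<bullet> x - b \<le> 0}"

(* Constraint data a_1,...,a_m and b_1,...,b_m are functions on nat; only the indices 1..m are used. *)
definition polyhedron_of :: "nat \<Rightarrow> (nat \<Rightarrow> real ^ 'n) \<Rightarrow> (nat \<Rightarrow> real) \<Rightarrow> (real ^ 'n) set" where
  "polyhedron_of m a b = (\<Inter>i\<in>{1..m}. halfspace (a i) (b i))"

(* Meaningful for nonempty closed convex Y, where closest_point is the Euclidean projection. *)
definition proj_dist :: "real ^ 'n \<Rightarrow> (real ^ 'n) set \<Rightarrow> real" where
  "proj_dist x Y = norm (x - closest_point Y x)"

definition penalty :: "real \<Rightarrow> real ^ 'n \<Rightarrow> real \<Rightarrow> real ^ 'n \<Rightarrow> real" where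
  "penalty \<delta> a b x =
    (if a \<bullet> x - b > \<delta> then (a \<bullet> x - b) / norm a
     else if - \<delta> \<le> a \<bullet> x - b then (a \<bullet> x - b + \<delta>)\<^sup>2 / (4 * \<delta> * norm a)
     else 0)"

definition penalized ::
  "(real ^ 'n \<Rightarrow> real) \<Rightarrow> nat \<Rightarrow> (nat \<Rightarrow> real ^ 'n) \<Rightarrow> (nat \<Rightarrow> real) \<Rightarrow> real \<Rightarrow> real \<Rightarrow> real ^ 'n \<Rightarrow> real"
  where
  "penalized f m a b \<gamma> \<delta> x = f x + \<gamma> / real m * (\<Sum>i=1..m. penalty \<delta> (a i) (b i) x)"

definition penalized_minimizers ::
  "(real ^ 'n \<Rightarrow> real) \<Rightarrow> nat \<Rightarrow> (nat \<Rightarrow> real ^ 'n) \<Rightarrow> (nat \<Rightarrow> real) \<Rightarrow> real \<Rightarrow> real \<Rightarrow> (real ^ 'n) set"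
  where
  "penalized_minimizers f m a b \<gamma> \<delta> =
    {x. \<forall>y. penalized f m a b \<gamma> \<delta> x \<le> penalized f m a b \<gamma> \<delta> y}"

definition alpha_min :: "nat \<Rightarrow> (nat \<Rightarrow> real ^ 'n) \<Rightarrow> real" where
  "alpha_min m a = Min ((\<lambda>j. norm (a j)) ` {1..m})"

definition alpha_max :: "nat \<Rightarrow> (nat \<Rightarrow> real ^ 'n) \<Rightarrow> real" where
  "alpha_max m a = Max ((\<lambda>j. norm (a j)) ` {1..m})"

(* The right-hand sides are quantified inside, so that \<beta> depends on the vectors a_i only. *)
definition hoffman_constant :: "nat \<Rightarrow> (nat \<Rightarrow> real ^ 'n) \<Rightarrow> real \<Rightarrow> bool" where
  "hoffman_constant m a \<beta> \<longleftrightarrow>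
    \<beta> > 0 \<and>
    (\<forall>b'. polyhedron_of m a b' \<noteq> {} \<longrightarrow>
      (\<forall>x. \<beta> * (\<Sum>i=1..m. proj_dist x (halfspace (a i) (b' i)))
            \<ge> proj_dist x (polyhedron_of m a b')))"

definition subdifferential :: "(real ^ 'n \<Rightarrow> real) \<Rightarrow> real ^ 'n \<Rightarrow> (real ^ 'n) set" where
  "subdifferential f x = {s. \<forall>y. f y \<ge> f x + s \<bullet> (y - x)}"

(* R is an admissible value of the radius R(c,\<epsilon>). *)
definition subgradient_radius ::
  "(real ^ 'n \<Rightarrow> real) \<Rightarrow> nat \<Rightarrow> (nat \<Rightarrow> real ^ 'n) \<Rightarrow> (nat \<Rightarrow> real) \<Rightarrow> real \<Rightarrow> real \<Rightarrow> real \<Rightarrow> real \<Rightarrow> bool"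
  where
  "subgradient_radius f m a b \<beta> c \<epsilon> R \<longleftrightarrow>
    R > 0 \<and>
    (\<forall>\<gamma> \<delta> x. \<gamma> > 0 \<longrightarrow> 0 < \<delta> \<longrightarrow> \<delta> \<le> \<epsilon> \<longrightarrow> \<gamma> * \<delta> \<le> c \<longrightarrow>
      x \<in> penalized_minimizers f m a b \<gamma> \<delta> \<longrightarrow>
        closest_point (polyhedron_of m a b) x \<in> cball 0 R \<and>
        (\<forall>x_in \<in> polyhedron_of m a b.
          norm (x - x_in) \<le> norm (x - closest_point (polyhedron_of m a b) x)
                             + \<beta> * real m * \<delta> / alpha_min m a
          \<longrightarrow> x_in \<in> cball 0 R))"

(* For convex f on R^n and R > 0 the set of subgradients at points of the ball is nonempty and
   compact, so the supremum is attained and equals the maximum. *)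
definition subgradient_bound :: "(real ^ 'n \<Rightarrow> real) \<Rightarrow> real \<Rightarrow> real" where
  "subgradient_bound f R = Sup {norm s | s x. s \<in> subdifferential f x \<and> norm x \<le> R}"

definition penalty_threshold :: "nat \<Rightarrow> (nat \<Rightarrow> real ^ 'n) \<Rightarrow> real \<Rightarrow> real \<Rightarrow> real \<Rightarrow> real" where
  "penalty_threshold m a \<beta> L \<delta> =
    max (L * inverse (1 / (real m * \<beta>) - sqrt \<delta> / (4 * alpha_min m a)))
        (4 * real m * L * alpha_max m a * (1 / sqrt \<delta> + \<beta> * real m / alpha_min m a))"

end

theory Submission
  imports Defs
begin

text \<open>
  Let \<open>x\<close> minimize the penalized objective, \<open>p\<close> be its projection onto the polyhedron \<open>X\<close>, and
  suppose that \<open>x \<notin> X\<close>. The penalty of each constraint dominates the distance to its half-space,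
  so by Hoffman's bound the total penalty at \<open>x\<close> is at least \<open>dist x X / \<beta>\<close>. Against this, moving
  from \<open>x\<close> to a point \<open>z\<close> of the ball of radius \<open>R\<close> raises \<open>f\<close> by at most \<open>L * norm (z - x)\<close>,
  since a subgradient of \<open>f\<close> at \<open>z\<close> has norm at most \<open>L\<close>. Comparing \<open>x\<close> with one well-chosen
  feasible point then forces \<open>\<gamma>\<close> below the threshold; which point works depends on how far \<open>x\<close> is
  from \<open>X\<close>.

  If \<open>dist x X > sqrt \<delta>\<close>, compare with \<open>p\<close>. The penalty need not vanish there, but it is at most
  \<open>\<delta> / (4 * norm (a i))\<close> per constraint, which is of lower order than \<open>dist x X\<close>; this gives
  the first term of the threshold (lemma \<open>far_minimizer_multiplier_bound\<close>).

  If \<open>dist x X \<le> sqrt \<delta>\<close>, compare with a point of the polyhedron shrunk by \<open>\<delta>\<close>, where every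
  penalty vanishes. It is nonempty by the Slater condition, and Hoffman's bound for the shifted
  right-hand sides (the same \<open>\<beta>\<close>) places such a point within \<open>\<beta> * m * \<delta> / alpha_min\<close> of \<open>p\<close>.
  A violated constraint costs more than \<open>\<delta> / (4 * alpha_max)\<close>, however small the violation,
  and this gives the second term (lemma \<open>near_minimizer_multiplier_bound\<close>).
\<close>

section \<open>Subgradients of finite convex functions\<close>

text \<open>
  A hyperplane separating the point \<open>(z, f z)\<close> from the strict epigraph of \<open>f\<close> cannot be vertical,
  because \<open>f\<close> is finite everywhere; its slope is a subgradient.
\<close>

lemma subdifferential_nonempty:
  fixes f :: "real ^ 'n \<Rightarrow> real"
  assumes f: "convex_on UNIV f"
  shows "subdifferential f z \<noteq> {}"
proof -
  let ?S = "{(y, t). f y < t}"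
  have "convex ?S"
  proof (rule convexI, clarsimp)
    fix y t y' t' and u v :: real
    assume *: "f y < t" "f y' < t'" "0 \<le> u" "0 \<le> v" "u + v = 1"
    have "f (u *\<^sub>R y + v *\<^sub>R y') \<le> u * f y + v * f y'"
      using f * by (auto simp: convex_on_def)
    also have "\<dots> < u * t + v * t'"
    proof (cases "u = 0")
      case False
      then show ?thesis
        using * by (intro add_less_le_mono mult_strict_left_mono mult_left_mono) auto
    qed (use * in auto)
    finally show "f (u *\<^sub>R y + v *\<^sub>R y') < u * t + v * t'" .
  qed
  moreover have "(z, f z + 1) \<in> ?S" "?S \<inter> {(z, f z)} = {}"
    by auto
  ultimately obtain w k where "w \<noteq> 0" and "\<forall>q\<in>?S. w \<bullet> q \<le> k" and "\<forall>q\<in>{(z, f z)}. w \<bullet> q \<ge> k"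
    using separating_hyperplane_sets[of ?S "{(z, f z)}"] by blast
  moreover obtain u \<tau> where w: "w = (u, \<tau>)"
    by (cases w)
  ultimately have nz: "(u, \<tau>) \<noteq> 0"
    and sep: "\<And>y t. f y < t \<Longrightarrow> u \<bullet> y + \<tau> * t \<le> u \<bullet> z + \<tau> * f z"
    by (force simp: inner_Pair)+
  have "\<tau> \<noteq> 0"
  proof
    assume "\<tau> = 0"
    then have "u \<bullet> (z + u) \<le> u \<bullet> z"
      using sep[of "z + u" "f (z + u) + 1"] by simp
    then have "u \<bullet> u \<le> 0"
      by (simp add: inner_add_right)
    then have "u = 0"
      using inner_gt_zero_iff[of u] by linarith
    with \<open>\<tau> = 0\<close> nz show False
      by (simp add: zero_prod_def)
  qed
  moreover have "\<tau> \<le> 0"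
    using sep[of z "f z + 1"] by (simp add: algebra_simps)
  ultimately have \<tau>: "\<tau> < 0"
    by simp
  have "f z + (u /\<^sub>R (- \<tau>)) \<bullet> (y - z) \<le> f y" for y
  proof (rule dense_ge)
    fix t assume "f y < t"
    then have "u \<bullet> (y - z) \<le> (- \<tau>) * (t - f z)"
      using sep[of y t] by (simp add: algebra_simps)
    then have "u \<bullet> (y - z) / (- \<tau>) \<le> t - f z"
      using \<tau> by (simp add: divide_simps mult.commute)
    then show "f z + (u /\<^sub>R (- \<tau>)) \<bullet> (y - z) \<le> t"
      by (simp add: divide_inverse mult.commute)
  qed
  then show ?thesis
    unfolding subdifferential_def by blast
qed

text \<open>
  A convex function is continuous, hence bounded on the ball of radius \<open>R + 1\<close>. A unit step from
  \<open>x\<close> in the direction of a subgradient \<open>s\<close> raises \<open>f\<close> by at least \<open>norm s\<close> and stays in that ball.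
\<close>

lemma bdd_above_subgradient_norms:
  fixes f :: "real ^ 'n \<Rightarrow> real"
  assumes f: "convex_on UNIV f"
  shows "bdd_above {norm s | s x. s \<in> subdifferential f x \<and> norm x \<le> R}"
proof -
  have "continuous_on (cball 0 (R + 1)) f"
    using convex_on_continuous[OF open_UNIV f] continuous_on_subset by blast
  then have "bounded (f ` cball 0 (R + 1))"
    by (intro compact_imp_bounded compact_continuous_image) auto
  then obtain M where M: "\<And>y. norm y \<le> R + 1 \<Longrightarrow> \<bar>f y\<bar> \<le> M"
    unfolding bounded_iff by fastforce
  have "norm s \<le> 2 * M" if s: "s \<in> subdifferential f x" and x: "norm x \<le> R" for s x
  proof -
    have "f x + s \<bullet> ((x + sgn s) - x) \<le> f (x + sgn s)"
      using s unfolding subdifferential_def by blast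
    moreover have "s \<bullet> sgn s = norm s"
      by (cases "s = 0") (simp_all add: sgn_div_norm dot_square_norm power2_eq_square)
    moreover have "norm (x + sgn s) \<le> R + 1"
      using norm_triangle_ineq[of x "sgn s"] x by (simp add: norm_sgn split: if_splits)
    moreover have "norm x \<le> R + 1"
      using x by simp
    ultimately show ?thesis
      using M[of x] M[of "x + sgn s"] by simp
  qed
  then show ?thesis
    by (auto intro!: bdd_aboveI[of _ "2 * M"])
qed

lemma norm_subgradient_le_bound:
  fixes f :: "real ^ 'n \<Rightarrow> real"
  assumes "convex_on UNIV f" "s \<in> subdifferential f z" "norm z \<le> R"
  shows "norm s \<le> subgradient_bound f R"
  unfolding subgradient_bound_def
  using assms by (intro cSup_upper bdd_above_subgradient_norms) auto

lemma subgradient_bound_nonneg: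
  fixes f :: "real ^ 'n \<Rightarrow> real"
  assumes "convex_on UNIV f" "R \<ge> 0"
  shows "subgradient_bound f R \<ge> 0"
proof -
  obtain s where "s \<in> subdifferential f 0"
    using subdifferential_nonempty[OF assms(1), of 0] by blast
  then have "norm s \<le> subgradient_bound f R"
    using norm_subgradient_le_bound[OF assms(1), of s 0 R] assms(2) by simp
  then show ?thesis
    using norm_ge_zero order_trans by blast
qed

text \<open>
  A one-sided Lipschitz estimate in which only the end point \<open>z\<close> is confined to the ball: the
  subgradient is taken at \<open>z\<close>, and \<open>x\<close> is arbitrary. This matters because \<open>x\<close> will be an infeasible
  minimizer, which need not lie in the ball.
\<close>

lemma convex_increase_le_subgradient_bound:
  fixes f :: "real ^ 'n \<Rightarrow> real"
  assumes f: "convex_on UNIV f" and z: "norm z \<le> R"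
  shows "f z - f x \<le> subgradient_bound f R * norm (x - z)"
proof -
  obtain s where s: "s \<in> subdifferential f z"
    using subdifferential_nonempty[OF f] by blast
  then have "f z + s \<bullet> (x - z) \<le> f x"
    unfolding subdifferential_def by blast
  then have "f z - f x \<le> \<bar>s \<bullet> (x - z)\<bar>"
    by linarith
  also have "\<dots> \<le> norm s * norm (x - z)"
    by (rule Cauchy_Schwarz_ineq2)
  also have "\<dots> \<le> subgradient_bound f R * norm (x - z)"
    using norm_subgradient_le_bound[OF f s z] by (intro mult_right_mono) auto
  finally show ?thesis .
qed

section \<open>Half-spaces, polyhedra and projections\<close>

lemma closed_halfspace: "closed (halfspace a b)"
  unfolding halfspace_def using closed_halfspace_le[of a b] by simp

lemma closed_polyhedron_of: "closed (polyhedron_of m a b)"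
  unfolding polyhedron_of_def by (intro closed_INT ballI closed_halfspace)

lemma mem_polyhedron_of:
  "x \<in> polyhedron_of m a b \<longleftrightarrow> (\<forall>i\<in>{1..m}. a i \<bullet> x - b i \<le> 0)"
  by (simp add: polyhedron_of_def halfspace_def)

lemma proj_dist_le:
  assumes "closed Y" "y \<in> Y"
  shows "proj_dist x Y \<le> norm (x - y)"
  using closest_point_le[OF assms, of x] by (simp add: proj_dist_def dist_norm)

lemma proj_dist_halfspace_le:
  assumes "a \<noteq> 0"
  shows "proj_dist x (halfspace a b) \<le> max (a \<bullet> x - b) 0 / norm a"
proof -
  \<comment> \<open>The foot of the perpendicular from \<open>x\<close> if \<open>x\<close> is outside, and \<open>x\<close> itself otherwise.\<close>
  define y where "y = x - (max (a \<bullet> x - b) 0 / (norm a)\<^sup>2) *\<^sub>R a"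
  have "a \<bullet> y = a \<bullet> x - max (a \<bullet> x - b) 0"
    using assms by (simp add: y_def inner_diff_right dot_square_norm)
  then have "y \<in> halfspace a b"
    by (simp add: halfspace_def)
  then have "proj_dist x (halfspace a b) \<le> norm (x - y)"
    by (rule proj_dist_le[OF closed_halfspace])
  also have "\<dots> = max (a \<bullet> x - b) 0 / norm a"
    using assms by (simp add: y_def power2_eq_square)
  finally show ?thesis .
qed

lemma alpha_min_le: "i \<in> {1..m} \<Longrightarrow> alpha_min m a \<le> norm (a i)"
  unfolding alpha_min_def by (intro Min_le) auto

lemma alpha_max_ge: "i \<in> {1..m} \<Longrightarrow> norm (a i) \<le> alpha_max m a"
  unfolding alpha_max_def by (intro Max_ge) auto

lemma alpha_min_pos:
  assumes "m \<ge> 1" "\<And>i. i \<in> {1..m} \<Longrightarrow> a i \<noteq> 0"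
  shows "alpha_min m a > 0"
  unfolding alpha_min_def using assms by (subst Min_gr_iff) auto

text \<open>
  Applying Hoffman's bound to the tightened right-hand sides \<open>b i - \<delta>\<close> at a feasible point \<open>p\<close>, which
  violates each of them by at most \<open>\<delta>\<close>.
\<close>

lemma hoffman_shrunk_polyhedron_point:
  assumes "m \<ge> 1" and a: "\<And>i. i \<in> {1..m} \<Longrightarrow> a i \<noteq> 0"
    and hoffman: "hoffman_constant m a \<beta>" and "\<delta> \<ge> 0"
    and nonempty: "polyhedron_of m a (\<lambda>i. b i - \<delta>) \<noteq> {}"
    and p: "p \<in> polyhedron_of m a b"
  obtains q where "q \<in> polyhedron_of m a (\<lambda>i. b i - \<delta>)"
    and "norm (p - q) \<le> \<beta> * real m * \<delta> / alpha_min m a"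
proof -
  let ?Y = "polyhedron_of m a (\<lambda>i. b i - \<delta>)"
  have \<alpha>: "alpha_min m a > 0"
    using assms by (intro alpha_min_pos) auto
  have "proj_dist p (halfspace (a i) (b i - \<delta>)) \<le> \<delta> / alpha_min m a" if i: "i \<in> {1..m}" for i
  proof -
    have "proj_dist p (halfspace (a i) (b i - \<delta>)) \<le> max (a i \<bullet> p - (b i - \<delta>)) 0 / norm (a i)"
      by (rule proj_dist_halfspace_le[OF a[OF i]])
    also have "\<dots> \<le> \<delta> / alpha_min m a"
    proof (rule frac_le)
      show "max (a i \<bullet> p - (b i - \<delta>)) 0 \<le> \<delta>"
        using p i \<open>\<delta> \<ge> 0\<close> by (auto simp: mem_polyhedron_of)
    qed (use \<alpha> alpha_min_le[OF i] \<open>\<delta> \<ge> 0\<close> in auto)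
    finally show ?thesis .
  qed
  then have "(\<Sum>i=1..m. proj_dist p (halfspace (a i) (b i - \<delta>))) \<le> real m * (\<delta> / alpha_min m a)"
    using sum_bounded_above[of "{1..m}" _ "\<delta> / alpha_min m a"] by simp
  then have "\<beta> * (\<Sum>i=1..m. proj_dist p (halfspace (a i) (b i - \<delta>)))
      \<le> \<beta> * (real m * (\<delta> / alpha_min m a))"
    using hoffman by (intro mult_left_mono) (auto simp: hoffman_constant_def)
  moreover have "proj_dist p ?Y \<le> \<beta> * (\<Sum>i=1..m. proj_dist p (halfspace (a i) (b i - \<delta>)))"
    using hoffman nonempty by (auto simp: hoffman_constant_def)
  ultimately have "norm (p - closest_point ?Y p) \<le> \<beta> * real m * \<delta> / alpha_min m a"
    by (simp add: proj_dist_def mult.assoc)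
  then show thesis
    by (intro that[of "closest_point ?Y p"] closest_point_in_set closed_polyhedron_of nonempty)
qed

section \<open>The smoothed penalty\<close>

lemma penalty_nonneg: "\<delta> > 0 \<Longrightarrow> penalty \<delta> a b x \<ge> 0"
  by (auto simp: penalty_def)

text \<open>
  In the quadratic zone this is \<open>(t + \<delta>)\<^sup>2 \<ge> 4 * \<delta> * t\<close>, that is, \<open>(t - \<delta>)\<^sup>2 \<ge> 0\<close>.
\<close>

lemma penalty_ge_violation:
  assumes "\<delta> > 0" "a \<noteq> 0"
  shows "max (a \<bullet> x - b) 0 / norm a \<le> penalty \<delta> a b x"
proof (cases "a \<bullet> x - b \<le> 0")
  case True
  then show ?thesis
    using penalty_nonneg[OF assms(1)] by (simp add: max_def)
next
  case False
  have "4 * \<delta> * (a \<bullet> x - b) \<le> (a \<bullet> x - b + \<delta>)\<^sup>2"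
    using zero_le_power2[of "a \<bullet> x - b - \<delta>"] by (simp add: power2_eq_square algebra_simps)
  then have "a \<bullet> x - b \<le> (a \<bullet> x - b + \<delta>)\<^sup>2 / (4 * \<delta>)"
    using assms by (simp add: pos_le_divide_eq mult.commute)
  then have "(a \<bullet> x - b) / norm a \<le> (a \<bullet> x - b + \<delta>)\<^sup>2 / (4 * \<delta>) / norm a"
    by (intro divide_right_mono) auto
  then have "(a \<bullet> x - b) / norm a \<le> (a \<bullet> x - b + \<delta>)\<^sup>2 / (4 * \<delta> * norm a)"
    by simp
  then show ?thesis
    using False assms by (auto simp: penalty_def max_def)
qed

lemma penalty_feasible_le:
  assumes "\<delta> > 0" "a \<noteq> 0" "a \<bullet> x - b \<le> 0"
  shows "penalty \<delta> a b x \<le> \<delta> / (4 * norm a)"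
proof (cases "- \<delta> \<le> a \<bullet> x - b")
  case True
  then have "(a \<bullet> x - b + \<delta>)\<^sup>2 \<le> \<delta>\<^sup>2"
    using assms by (intro power_mono) auto
  then have "(a \<bullet> x - b + \<delta>)\<^sup>2 / (4 * \<delta> * norm a) \<le> \<delta>\<^sup>2 / (4 * \<delta> * norm a)"
    using assms by (intro divide_right_mono) auto
  also have "\<dots> = \<delta> / (4 * norm a)"
    using assms by (simp add: power2_eq_square)
  finally show ?thesis
    using True assms by (simp add: penalty_def)
qed (use assms in \<open>auto simp: penalty_def\<close>)

lemma penalty_infeasible_gt:
  assumes "\<delta> > 0" "a \<noteq> 0" "a \<bullet> x - b > 0"
  shows "penalty \<delta> a b x > \<delta> / (4 * norm a)"
proof (cases "a \<bullet> x - b > \<delta>")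
  case True
  then have "\<delta> / 4 < a \<bullet> x - b"
    using assms by simp
  then have "\<delta> / 4 / norm a < (a \<bullet> x - b) / norm a"
    using assms by (intro divide_strict_right_mono) auto
  then show ?thesis
    using True by (simp add: penalty_def)
next
  case False
  have "\<delta>\<^sup>2 < (a \<bullet> x - b + \<delta>)\<^sup>2"
    using assms by (intro power_strict_mono) auto
  then have "\<delta>\<^sup>2 / (4 * \<delta> * norm a) < (a \<bullet> x - b + \<delta>)\<^sup>2 / (4 * \<delta> * norm a)"
    using assms by (intro divide_strict_right_mono) auto
  moreover have "\<delta>\<^sup>2 / (4 * \<delta> * norm a) = \<delta> / (4 * norm a)"
    using assms by (simp add: power2_eq_square)
  ultimately show ?thesis
    using False assms by (simp add: penalty_def)
qed

lemma penalty_deep_interior: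
  assumes "a \<bullet> x - b \<le> - \<delta>" "\<delta> > 0"
  shows "penalty \<delta> a b x = 0"
proof (cases "a \<bullet> x - b = - \<delta>")
  case True
  then have "a \<bullet> x - b + \<delta> = 0"
    by simp
  then show ?thesis
    using assms unfolding penalty_def by simp
qed (use assms in \<open>auto simp: penalty_def\<close>)

lemma sum_penalty_ge_distance:
  assumes a: "\<And>i. i \<in> {1..m} \<Longrightarrow> a i \<noteq> 0" and "\<delta> > 0"
    and hoffman: "hoffman_constant m a \<beta>" and nonempty: "polyhedron_of m a b \<noteq> {}"
  shows "proj_dist x (polyhedron_of m a b) / \<beta> \<le> (\<Sum>i=1..m. penalty \<delta> (a i) (b i) x)"
proof -
  have \<beta>: "\<beta> > 0"
    using hoffman by (simp add: hoffman_constant_def)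
  have "proj_dist x (polyhedron_of m a b) \<le> \<beta> * (\<Sum>i=1..m. proj_dist x (halfspace (a i) (b i)))"
    using hoffman nonempty by (auto simp: hoffman_constant_def)
  also have "\<dots> \<le> \<beta> * (\<Sum>i=1..m. penalty \<delta> (a i) (b i) x)"
    using \<beta> a proj_dist_halfspace_le penalty_ge_violation[OF \<open>\<delta> > 0\<close>]
    by (intro mult_left_mono sum_mono) (blast intro: order_trans, simp)
  finally show ?thesis
    using \<beta> by (simp add: divide_simps mult.commute)
qed

lemma sum_penalty_feasible_le:
  assumes "m \<ge> 1" and a: "\<And>i. i \<in> {1..m} \<Longrightarrow> a i \<noteq> 0" and "\<delta> > 0"
    and p: "p \<in> polyhedron_of m a b"
  shows "(\<Sum>i=1..m. penalty \<delta> (a i) (b i) p) \<le> real m * (\<delta> / (4 * alpha_min m a))"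
proof -
  have \<alpha>: "alpha_min m a > 0"
    using assms by (intro alpha_min_pos) auto
  have "penalty \<delta> (a i) (b i) p \<le> \<delta> / (4 * alpha_min m a)" if i: "i \<in> {1..m}" for i
  proof -
    have pos: "norm (a i) > 0"
      using a[OF i] by simp
    have "penalty \<delta> (a i) (b i) p \<le> \<delta> / (4 * norm (a i))"
      using p i a by (intro penalty_feasible_le \<open>\<delta> > 0\<close>) (auto simp: mem_polyhedron_of)
    also have "\<dots> \<le> \<delta> / (4 * alpha_min m a)"
      using \<alpha> pos alpha_min_le[OF i, of a] \<open>\<delta> > 0\<close> by (intro divide_left_mono mult_pos_pos) auto
    finally show ?thesis .
  qed
  then show ?thesis
    using sum_bounded_above[of "{1..m}" _ "\<delta> / (4 * alpha_min m a)"] by simp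
qed

lemma sum_penalty_infeasible_gt:
  assumes a: "\<And>i. i \<in> {1..m} \<Longrightarrow> a i \<noteq> 0" and "\<delta> > 0"
    and x: "x \<notin> polyhedron_of m a b"
  shows "(\<Sum>i=1..m. penalty \<delta> (a i) (b i) x) > \<delta> / (4 * alpha_max m a)"
proof -
  obtain i where i: "i \<in> {1..m}" and viol: "a i \<bullet> x - b i > 0"
    using x by (force simp: mem_polyhedron_of)
  have "norm (a i) > 0"
    using a[OF i] by simp
  then have "\<delta> / (4 * alpha_max m a) \<le> \<delta> / (4 * norm (a i))"
    using alpha_max_ge[OF i, of a] \<open>\<delta> > 0\<close> by (intro divide_left_mono mult_pos_pos) linarith+
  also have "\<dots> < penalty \<delta> (a i) (b i) x"
    by (rule penalty_infeasible_gt[OF \<open>\<delta> > 0\<close> a[OF i] viol])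
  also have "\<dots> \<le> (\<Sum>i=1..m. penalty \<delta> (a i) (b i) x)"
    using i penalty_nonneg[OF \<open>\<delta> > 0\<close>] by (intro member_le_sum) auto
  finally show ?thesis .
qed

section \<open>Infeasible minimizers force a small penalty parameter\<close>

text \<open>
  Optimality of \<open>x\<close> against a point \<open>z\<close> of the ball: what is saved in the penalty is paid in \<open>f\<close>.
\<close>

lemma minimizer_penalty_gain_le:
  assumes "convex_on UNIV f" and x: "x \<in> penalized_minimizers f m a b \<gamma> \<delta>" and "norm z \<le> R"
  shows "\<gamma> / real m * ((\<Sum>i=1..m. penalty \<delta> (a i) (b i) x) - (\<Sum>i=1..m. penalty \<delta> (a i) (b i) z))
    \<le> subgradient_bound f R * norm (x - z)"
proof -
  have "penalized f m a b \<gamma> \<delta> x \<le> penalized f m a b \<gamma> \<delta> z"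
    using x by (simp add: penalized_minimizers_def)
  then have "\<gamma> / real m * ((\<Sum>i=1..m. penalty \<delta> (a i) (b i) x) - (\<Sum>i=1..m. penalty \<delta> (a i) (b i) z))
      \<le> f z - f x"
    unfolding penalized_def right_diff_distrib by linarith
  also have "\<dots> \<le> subgradient_bound f R * norm (x - z)"
    using assms by (intro convex_increase_le_subgradient_bound)
  finally show ?thesis .
qed

text \<open>
  With \<open>d = dist x X\<close>, the penalty saved by moving to the projection is at least
  \<open>d / \<beta> - m * \<delta> / (4 * alpha_min)\<close>, and \<open>\<delta> < sqrt \<delta> * d\<close> makes it proportional to \<open>d\<close>.
\<close>

lemma far_minimizer_multiplier_bound:
  assumes "m \<ge> 1" and a: "\<And>i. i \<in> {1..m} \<Longrightarrow> a i \<noteq> 0"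
    and nonempty: "polyhedron_of m a b \<noteq> {}" and f: "convex_on UNIV f"
    and hoffman: "hoffman_constant m a \<beta>" and "\<gamma> > 0" "\<delta> > 0"
    and x: "x \<in> penalized_minimizers f m a b \<gamma> \<delta>"
    and ball: "norm (closest_point (polyhedron_of m a b) x) \<le> R"
    and far: "proj_dist x (polyhedron_of m a b) > sqrt \<delta>"
  shows "\<gamma> * (1 / (real m * \<beta>) - sqrt \<delta> / (4 * alpha_min m a)) < subgradient_bound f R"
proof -
  define \<alpha> where "\<alpha> = alpha_min m a"
  define p where "p = closest_point (polyhedron_of m a b) x"
  define d where "d = norm (x - p)"
  have d: "proj_dist x (polyhedron_of m a b) = d"
    by (simp add: proj_dist_def d_def p_def)
  have \<alpha>: "\<alpha> > 0"
    unfolding \<alpha>_def using assms by (intro alpha_min_pos) auto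
  have \<beta>: "\<beta> > 0"
    using hoffman by (simp add: hoffman_constant_def)
  have m: "real m > 0"
    using \<open>m \<ge> 1\<close> by simp
  have p: "p \<in> polyhedron_of m a b"
    unfolding p_def by (intro closest_point_in_set closed_polyhedron_of nonempty)
  have sqrt_d: "sqrt \<delta> < d"
    using far d by simp
  have d_pos: "d > 0"
    using less_trans[OF real_sqrt_gt_zero[OF \<open>\<delta> > 0\<close>] sqrt_d] .
  have \<delta>_d: "\<delta> < sqrt \<delta> * d"
    using mult_strict_left_mono[OF sqrt_d, of "sqrt \<delta>"] \<open>\<delta> > 0\<close> by simp
  have "real m * (\<delta> / (4 * \<alpha>)) < real m * (sqrt \<delta> * d / (4 * \<alpha>))"
    using \<delta>_d m \<alpha> by (intro mult_strict_left_mono divide_strict_right_mono) auto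
  then have gain: "d / \<beta> - real m * (sqrt \<delta> * d / (4 * \<alpha>))
      < (\<Sum>i=1..m. penalty \<delta> (a i) (b i) x) - (\<Sum>i=1..m. penalty \<delta> (a i) (b i) p)"
    using sum_penalty_ge_distance[OF a \<open>\<delta> > 0\<close> hoffman nonempty, of x]
      sum_penalty_feasible_le[OF \<open>m \<ge> 1\<close> a \<open>\<delta> > 0\<close> p] d \<alpha>_def by simp
  have "\<gamma> * (1 / (real m * \<beta>) - sqrt \<delta> / (4 * \<alpha>)) * d
      = \<gamma> / real m * (d / \<beta> - real m * (sqrt \<delta> * d / (4 * \<alpha>)))"
    using m \<beta> \<alpha> by (simp add: field_simps)
  also have "\<dots> < \<gamma> / real m
      * ((\<Sum>i=1..m. penalty \<delta> (a i) (b i) x) - (\<Sum>i=1..m. penalty \<delta> (a i) (b i) p))"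
    using gain \<open>\<gamma> > 0\<close> m by (intro mult_strict_left_mono) auto
  also have "\<dots> \<le> subgradient_bound f R * d"
    unfolding d_def using minimizer_penalty_gain_le[OF f x] ball by (simp add: p_def)
  finally show ?thesis
    using d_pos by (simp add: \<alpha>_def)
qed

text \<open>
  The comparison point \<open>q\<close> has zero penalty, and its distance to \<open>x\<close> is bounded by
  \<open>dist x X + \<beta> * m * \<delta> / alpha_min\<close>, which is exactly the slack that defines the radius \<open>R\<close>.
\<close>

lemma near_minimizer_multiplier_bound:
  assumes "m \<ge> 1" and a: "\<And>i. i \<in> {1..m} \<Longrightarrow> a i \<noteq> 0"
    and slater: "\<And>j. j \<in> {1..m} \<Longrightarrow> a j \<bullet> xbar - b j \<le> - \<epsilon>"
    and f: "convex_on UNIV f"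
    and hoffman: "hoffman_constant m a \<beta>" and "\<gamma> > 0" "0 < \<delta>" "\<delta> \<le> \<epsilon>" "\<gamma> * \<delta> \<le> c"
    and radius: "subgradient_radius f m a b \<beta> c \<epsilon> R"
    and x: "x \<in> penalized_minimizers f m a b \<gamma> \<delta>"
    and infeasible: "x \<notin> polyhedron_of m a b"
    and near: "proj_dist x (polyhedron_of m a b) \<le> sqrt \<delta>"
  shows "\<gamma> < 4 * real m * subgradient_bound f R * alpha_max m a
    * (1 / sqrt \<delta> + \<beta> * real m / alpha_min m a)"
proof -
  define p where "p = closest_point (polyhedron_of m a b) x"
  have m: "real m > 0"
    using \<open>m \<ge> 1\<close> by simp
  have \<alpha>: "alpha_min m a > 0"
    using assms by (intro alpha_min_pos) auto
  then have \<alpha>': "alpha_max m a > 0"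
    using alpha_min_le[of 1 m a] alpha_max_ge[of 1 m a] \<open>m \<ge> 1\<close> by simp
  have L: "subgradient_bound f R \<ge> 0"
    using radius by (intro subgradient_bound_nonneg f) (simp add: subgradient_radius_def)
  have slater_\<delta>: "a j \<bullet> xbar - b j \<le> - \<delta>" if "j \<in> {1..m}" for j
    using slater[OF that] \<open>\<delta> \<le> \<epsilon>\<close> by simp
  then have shrunk: "polyhedron_of m a (\<lambda>i. b i - \<delta>) \<noteq> {}"
    using mem_polyhedron_of[of xbar m a "\<lambda>i. b i - \<delta>"] by fastforce
  have shrunk_subset: "polyhedron_of m a (\<lambda>i. b i - \<delta>) \<subseteq> polyhedron_of m a b"
    using \<open>\<delta> > 0\<close> by (fastforce simp: mem_polyhedron_of)
  have p: "p \<in> polyhedron_of m a b"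
    unfolding p_def using shrunk shrunk_subset
    by (intro closest_point_in_set closed_polyhedron_of) auto
  obtain q where q: "q \<in> polyhedron_of m a (\<lambda>i. b i - \<delta>)"
    and pq: "norm (p - q) \<le> \<beta> * real m * \<delta> / alpha_min m a"
    using hoffman_shrunk_polyhedron_point[OF \<open>m \<ge> 1\<close> a hoffman _ shrunk p] \<open>\<delta> > 0\<close> by auto
  have xq: "norm (x - q) \<le> norm (x - p) + \<beta> * real m * \<delta> / alpha_min m a"
    using norm_triangle_ineq[of "x - p" "p - q"] pq by simp
  have q_ball: "norm q \<le> R"
    using radius x q shrunk_subset xq \<open>\<gamma> > 0\<close> \<open>\<delta> > 0\<close> \<open>\<delta> \<le> \<epsilon>\<close> \<open>\<gamma> * \<delta> \<le> c\<close>
    unfolding subgradient_radius_def p_def by (auto simp: subset_iff)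
  have "penalty \<delta> (a i) (b i) q = 0" if "i \<in> {1..m}" for i
  proof (rule penalty_deep_interior[OF _ \<open>\<delta> > 0\<close>])
    have "a i \<bullet> q - (b i - \<delta>) \<le> 0"
      using q that by (simp add: mem_polyhedron_of)
    then show "a i \<bullet> q - b i \<le> - \<delta>"
      by simp
  qed
  then have "(\<Sum>i=1..m. penalty \<delta> (a i) (b i) q) = 0"
    by simp
  then have upper_q:
    "\<gamma> / real m * (\<Sum>i=1..m. penalty \<delta> (a i) (b i) x) \<le> subgradient_bound f R * norm (x - q)"
    using minimizer_penalty_gain_le[OF f x q_ball] by simp
  have scale: "sqrt \<delta> + \<beta> * real m * \<delta> / alpha_min m a
      = \<delta> * (1 / sqrt \<delta> + \<beta> * real m / alpha_min m a)"
    using \<open>\<delta> > 0\<close> real_div_sqrt[of \<delta>] by (simp add: distrib_left mult_ac)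
  note upper_q
  also have "subgradient_bound f R * norm (x - q)
      \<le> subgradient_bound f R * (sqrt \<delta> + \<beta> * real m * \<delta> / alpha_min m a)"
    using xq near L by (intro mult_left_mono) (simp_all add: proj_dist_def p_def)
  also have "\<dots> = \<delta> * (subgradient_bound f R * (1 / sqrt \<delta> + \<beta> * real m / alpha_min m a))"
    unfolding scale by simp
  finally have upper: "\<gamma> / real m * (\<Sum>i=1..m. penalty \<delta> (a i) (b i) x)
      \<le> \<delta> * (subgradient_bound f R * (1 / sqrt \<delta> + \<beta> * real m / alpha_min m a))" .
  have "\<delta> * (\<gamma> / real m / (4 * alpha_max m a)) = \<gamma> / real m * (\<delta> / (4 * alpha_max m a))"
    by simp
  also have "\<dots> < \<gamma> / real m * (\<Sum>i=1..m. penalty \<delta> (a i) (b i) x)"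
    using sum_penalty_infeasible_gt[OF a \<open>\<delta> > 0\<close> infeasible] \<open>\<gamma> > 0\<close> m
    by (intro mult_strict_left_mono) auto
  also note upper
  finally have "\<gamma> / real m / (4 * alpha_max m a)
      < subgradient_bound f R * (1 / sqrt \<delta> + \<beta> * real m / alpha_min m a)"
    using \<open>\<delta> > 0\<close> by (simp only: mult_less_cancel_left_pos)
  then show ?thesis
    using m \<alpha>' by (simp add: pos_divide_less_eq mult_ac)
qed

text \<open>
  The upper bound on \<open>\<delta>\<close> makes the bracket inverted in the first term of the threshold positive.
\<close>

lemma threshold_denominator_pos:
  assumes "\<mu> > 0" "\<beta> > 0" "\<alpha> > (0::real)" "\<delta> < 16 * \<alpha>\<^sup>2 / (\<beta>\<^sup>2 * \<mu>\<^sup>2)"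
  shows "1 / (\<mu> * \<beta>) - sqrt \<delta> / (4 * \<alpha>) > 0"
proof -
  have "16 * \<alpha>\<^sup>2 / (\<beta>\<^sup>2 * \<mu>\<^sup>2) = (4 * \<alpha> / (\<mu> * \<beta>))\<^sup>2"
    by (simp add: power_divide power_mult_distrib mult.commute)
  then have "sqrt \<delta> < 4 * \<alpha> / (\<mu> * \<beta>)"
    using assms by (intro real_less_lsqrt) auto
  then show ?thesis
    using assms by (simp add: field_simps)
qed

theorem proposition1:
  fixes f :: "real ^ 'n \<Rightarrow> real"
    and a :: "nat \<Rightarrow> real ^ 'n" and b :: "nat \<Rightarrow> real" and m :: nat
    and xbar :: "real ^ 'n"
    and \<beta> c \<epsilon> R L \<gamma> \<delta> :: real
  assumes "m \<ge> 2"
    and "\<And>i. i \<in> {1..m} \<Longrightarrow> a i \<noteq> 0"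
    and "polyhedron_of m a b \<noteq> {}"
    and "convex_on UNIV f"
    and "\<And>t. bounded {x. f x \<le> t}"
    and "\<epsilon> > 0"
    and "\<And>j. j \<in> {1..m} \<Longrightarrow> a j \<bullet> xbar - b j \<le> - \<epsilon>"
    and "hoffman_constant m a \<beta>"
    and "c > 0"
    and "subgradient_radius f m a b \<beta> c \<epsilon> R"
    and "L = subgradient_bound f R"
    and "\<gamma> > 0"
    and "0 < \<delta>"
    and "\<delta> < min \<epsilon> (16 * (alpha_min m a)\<^sup>2 / (\<beta>\<^sup>2 * (real m)\<^sup>2))"
    and "\<gamma> * \<delta> \<le> c"
    and "\<gamma> \<ge> penalty_threshold m a \<beta> L \<delta>"
  shows "penalized_minimizers f m a b \<gamma> \<delta> \<subseteq> polyhedron_of m a b"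
proof
  fix x assume x: "x \<in> penalized_minimizers f m a b \<gamma> \<delta>"
  have m: "m \<ge> 1"
    using \<open>m \<ge> 2\<close> by simp
  have \<delta>: "\<delta> \<le> \<epsilon>" "\<delta> < 16 * (alpha_min m a)\<^sup>2 / (\<beta>\<^sup>2 * (real m)\<^sup>2)"
    using assms(14) by auto
  show "x \<in> polyhedron_of m a b"
  proof (rule ccontr)
    assume infeasible: "x \<notin> polyhedron_of m a b"
    show False
    proof (cases "proj_dist x (polyhedron_of m a b) > sqrt \<delta>")
      case True
      have "norm (closest_point (polyhedron_of m a b) x) \<le> R"
        using assms(10) x \<delta>(1) \<open>\<gamma> > 0\<close> \<open>0 < \<delta>\<close> \<open>\<gamma> * \<delta> \<le> c\<close>
        unfolding subgradient_radius_def by auto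
      then have "\<gamma> * (1 / (real m * \<beta>) - sqrt \<delta> / (4 * alpha_min m a)) < L"
        unfolding \<open>L = subgradient_bound f R\<close>
        using far_minimizer_multiplier_bound[OF m assms(2,3,4,8,12,13) x _ True] by blast
      moreover have "1 / (real m * \<beta>) - sqrt \<delta> / (4 * alpha_min m a) > 0"
        using m \<delta>(2) assms(8) alpha_min_pos[OF m assms(2)]
        by (intro threshold_denominator_pos) (auto simp: hoffman_constant_def)
      ultimately have "\<gamma> < L * inverse (1 / (real m * \<beta>) - sqrt \<delta> / (4 * alpha_min m a))"
        by (simp add: divide_inverse[symmetric] pos_less_divide_eq)
      then show False
        using assms(16) by (simp add: penalty_threshold_def)
    next
      case False
      then have "\<gamma> < 4 * real m * L * alpha_max m a * (1 / sqrt \<delta> + \<beta> * real m / alpha_min m a)"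
        unfolding \<open>L = subgradient_bound f R\<close>
        using near_minimizer_multiplier_bound[OF m assms(2,7,4,8,12,13) \<delta>(1) assms(15,10) x infeasible]
        by simp
      then show False
        using assms(16) by (simp add: penalty_threshold_def)
    qed
  qed
qed

end
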